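(* Let $\kappa\leq\lambda$ be infinite cardinals. Assume that $\mathrm{minnon}\geq\lambda$ and that there is a $\lambda$-dominating system on $\kappa\times\lambda$. Then $\mathbf{D}_\lambda^\lambda\preceq_{\mathrm{T}}\mathcal{SN}$, where $\mathcal{SN}$ is viewed as the relational system $\langle\mathcal{SN},\mathcal{SN},\subseteq\rangle$.
   Context: A relational system is a triple $\langle X,Y,R\rangle$ with $R\subseteq X\times Y$. For relational systems $\mathbf{R}=\langle X,Y,R\rangle$, $\mathbf{R}'=\langle X',Y',R'\rangle$, $\mathbf{R}\preceq_{\mathrm{T}}\mathbf{R}'$ means there are maps $\Psi_1:X\to X'$, $\Psi_2:Y'\to Y$ such that for all $x\in X$, $y'\in Y'$, $\Psi_1(x)R'y'$ implies $xR\Psi_2(y')$. $\mathbf{D}_\lambda^\lambda=\langle\lambda^\lambda,\lambda^\lambda,\leq\rangle$ with $f\leq g$ iff $f(\alpha)\leq g(\alpha)$ for all $\alpha<\lambda$ ($\lambda$ ordered as an ordinal). $\kappa\times\lambda$ is ordered coordinatewise: $(\alpha,\beta)\leq(\alpha',\beta')$ iff $\alpha\leq\alpha'$ and $\beta\leq\beta'$; its minimum is $(0,0)$. Strong measure zero: $X\subseteq 2^\omega$ has strong measure zero iff for every $f\in\omega^\omega$ there is $\sigma\in(2^{<\omega})^\omega$ with $|\sigma(n)|=f(n)$ for all $n$ and $X\subseteq\bigcup_n[\sigma(n)]$. $\mathcal{SN}$ is the family of such sets. Yorioka ideals: for $\sigma\in(2^{<\omega})^\omega$ let $\mathrm{ht}_\sigma(i)=|\sigma(i)|$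 and $[\sigma]_\infty=\{x\in2^\omega:\exists^\infty n\,(\sigma(n)\subseteq x)\}$. Let $\mathrm{pw}_k(i)=i^k$ and $f\ll g$ iff $f\circ\mathrm{pw}_k\leq^* g$ for every $k$. For increasing $f\in\omega^\omega$, $\mathcal{I}_f=\{X\subseteq2^\omega:\exists\sigma\,(X\subseteq[\sigma]_\infty\text{ and } f\ll\mathrm{ht}_\sigma)\}$. $\mathrm{non}(\mathcal{I}_f)$ is the least size of a subset of $2^\omega$ not in $\mathcal{I}_f$, and $\mathrm{minnon}=\min\{\mathrm{non}(\mathcal{I}_f): f\in\omega^\omega\text{ increasing}\}$. For increasing $f$ and a directed partial order $S$, an $\mathcal{I}_f$ directed system on $S$ is a family $\langle A_i^f: i\in S\rangle$ with (I) each $A_i^f$ a dense $G_\delta$ subset of $2^\omega$ in $\mathcal{I}_f$; (II) $i\leq j\Rightarrow A_i^f\subseteq A_j^f$; (III) every member of $\mathcal{I}_f$ is contained in some $A_i^f$. If $S$ has minimum $i_0$, a $\lambda$-dominating system on $S$ is a family $\langle A^{f_\gamma}:\gamma<\lambda\rangle$ where $\{f_\gamma:\gamma<\lambda\}$ is a $\leq^*$-dominating family of increasing functions in $\omega^\omega$, each $A^{f_\gamma}$ is an $\mathcal{I}_{f_\gamma}$ directed system on $S$, and $\bigcap_{\eta<\gamma}A_{i_0}^{f_\eta}\notin\mathcal{I}_{f_\gamma}$ for every $\gamma<\lambda$. *)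

theory Defs
  imports "HOL-Analysis.Analysis"
begin

unbundle cardinal_syntax

text \<open>Cardinals are the cardinal orders of the BNF library, i.e. well-orders of minimal
  cardinality on their field. A cardinal \<open>\<lambda>\<close> thus doubles as the ordinal \<open>\<lambda>\<close>: its elements
  are \<open>Field \<lambda>\<close>, and \<open>(\<alpha>, \<beta>) \<in> \<lambda>\<close> means \<open>\<alpha> \<le> \<beta>\<close>. Partial orders are likewise (reflexive)
  relations, with their field as underlying set.\<close>


section \<open>Relational systems and Tukey reductions\<close>

type_synonym ('x, 'y) relsys = "'x set \<times> 'y set \<times> ('x \<times> 'y) set"

definition relsys :: "('x, 'y) relsys \<Rightarrow> bool" where
  "relsys = (\<lambda>(X, Y, R). R \<subseteq> X \<times> Y)"

definition tukey_le :: "('x, 'y) relsys \<Rightarrow> ('u, 'v) relsys \<Rightarrow> bool"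
    (infix \<open>\<preceq>\<^sub>T\<close> 50) where
  "S \<preceq>\<^sub>T S' \<longleftrightarrow>
    (case S of (X, Y, R) \<Rightarrow> case S' of (X', Y', R') \<Rightarrow>
      \<exists>\<Psi>\<^sub>1 \<in> X \<rightarrow> X'. \<exists>\<Psi>\<^sub>2 \<in> Y' \<rightarrow> Y.
        \<forall>x\<in>X. \<forall>y'\<in>Y'. (\<Psi>\<^sub>1 x, y') \<in> R' \<longrightarrow> (x, \<Psi>\<^sub>2 y') \<in> R)"

definition self_maps :: "'l rel \<Rightarrow> ('l \<Rightarrow> 'l) set" where
  "self_maps lam = Field lam \<rightarrow>\<^sub>E Field lam"

definition dom_sys :: "'l rel \<Rightarrow> ('l \<Rightarrow> 'l, 'l \<Rightarrow> 'l) relsys" where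
  "dom_sys lam =
    (self_maps lam, self_maps lam,
     {(f, g) \<in> self_maps lam \<times> self_maps lam. \<forall>\<alpha>\<in>Field lam. (f \<alpha>, g \<alpha>) \<in> lam})"

definition incl_sys :: "'a set set \<Rightarrow> ('a set, 'a set) relsys" where
  "incl_sys J = (J, J, {(A, B) \<in> J \<times> J. A \<subseteq> B})"

lemma relsys_dom_sys: "relsys (dom_sys lam)"
  by (auto simp: relsys_def dom_sys_def)

lemma relsys_incl_sys: "relsys (incl_sys J)"
  by (auto simp: relsys_def incl_sys_def)


section \<open>The Cantor space and strong measure zero sets\<close>

text \<open>The topology on \<open>nat \<Rightarrow> bool\<close> is the product topology of the function type, with
  \<open>bool\<close> discrete.\<close>

type_synonym cantor = "nat \<Rightarrow> bool"

definition initial_seg :: "bool list \<Rightarrow> cantor \<Rightarrow> bool" where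
  "initial_seg s x \<longleftrightarrow> (\<forall>i < length s. x i = s ! i)"

definition cyl :: "bool list \<Rightarrow> cantor set" where
  "cyl s = {x. initial_seg s x}"

definition strong_measure_zero :: "cantor set \<Rightarrow> bool" where
  "strong_measure_zero X \<longleftrightarrow>
    (\<forall>f :: nat \<Rightarrow> nat. \<exists>\<sigma> :: nat \<Rightarrow> bool list.
      (\<forall>n. length (\<sigma> n) = f n) \<and> X \<subseteq> (\<Union>n. cyl (\<sigma> n)))"

definition SN :: "cantor set set" where
  "SN = {X. strong_measure_zero X}"


section \<open>Yorioka ideals\<close>

definition le_star :: "(nat \<Rightarrow> nat) \<Rightarrow> (nat \<Rightarrow> nat) \<Rightarrow> bool" (infix \<open>\<le>\<^sup>*\<close> 50) where
  "f \<le>\<^sup>* g \<longleftrightarrow> (\<forall>\<^sub>F n in sequentially. f n \<le> g n)"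

definition ht :: "(nat \<Rightarrow> bool list) \<Rightarrow> nat \<Rightarrow> nat" where
  "ht \<sigma> i = length (\<sigma> i)"

definition cyl_inf :: "(nat \<Rightarrow> bool list) \<Rightarrow> cantor set" where
  "cyl_inf \<sigma> = {x. \<exists>\<^sub>\<infinity>n. initial_seg (\<sigma> n) x}"

definition pw :: "nat \<Rightarrow> nat \<Rightarrow> nat" where
  "pw k i = i ^ k"

definition much_less :: "(nat \<Rightarrow> nat) \<Rightarrow> (nat \<Rightarrow> nat) \<Rightarrow> bool" (infix \<open>\<lless>\<close> 50) where
  "f \<lless> g \<longleftrightarrow> (\<forall>k. f \<circ> pw k \<le>\<^sup>* g)"

text \<open>``Increasing'' has to be read strictly: for a bounded \<open>f\<close> the family below would contain
  the whole space, and \<open>non\<close> of it would be undefined.\<close>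

definition yorioka :: "(nat \<Rightarrow> nat) \<Rightarrow> cantor set set" where
  "yorioka f = {X. \<exists>\<sigma>. X \<subseteq> cyl_inf \<sigma> \<and> f \<lless> ht \<sigma>}"

lemma UNIV_notin_yorioka:
  assumes "strict_mono f"
  shows "UNIV \<notin> yorioka f"
proof
  assume "UNIV \<in> yorioka f"
  then obtain \<sigma> where \<sigma>: "\<And>x. x \<in> cyl_inf \<sigma>" and f: "f \<lless> ht \<sigma>"
    by (auto simp: yorioka_def)
  from f obtain N where N: "\<And>i. i \<ge> N \<Longrightarrow> f (i ^ 2) \<le> length (\<sigma> i)"
    unfolding much_less_def le_star_def eventually_sequentially pw_def ht_def comp_def
    by metis
  have len: "i < length (\<sigma> i)" if "i \<ge> max N 2" for i
  proof -
    have "i < i ^ 2" using that by (simp add: power2_eq_square)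
    also have "\<dots> \<le> f (i ^ 2)" by (rule strict_mono_imp_increasing [OF assms])
    also have "\<dots> \<le> length (\<sigma> i)" using N that by simp
    finally show ?thesis .
  qed
  define x :: cantor where "x i = (\<not> \<sigma> i ! i)" for i
  from \<sigma>[of x] have "\<forall>m. \<exists>n\<ge>m. initial_seg (\<sigma> n) x"
    by (simp add: cyl_inf_def INFM_nat_le)
  then obtain i where "i \<ge> max N 2" "initial_seg (\<sigma> i) x" by blast
  with len[of i] show False by (auto simp: initial_seg_def x_def)
qed

text \<open>The least cardinal of a nonempty family; as with \<^const>\<open>card_of\<close>, it is determined up to
  isomorphism only.\<close>

definition min_card :: "'a rel set \<Rightarrow> 'a rel" where
  "min_card C = (SOME c. c \<in> C \<and> (\<forall>d\<in>C. c \<le>o d))"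

lemma min_card:
  assumes "C \<noteq> {}" "\<forall>c\<in>C. Card_order c"
  shows "min_card C \<in> C" and "\<And>d. d \<in> C \<Longrightarrow> min_card C \<le>o d"
proof -
  have "min_card C \<in> C \<and> (\<forall>d\<in>C. min_card C \<le>o d)"
    unfolding min_card_def
    by (rule someI_ex) (use exists_minim_Card_order[OF assms] in blast)
  then show "min_card C \<in> C" and "\<And>d. d \<in> C \<Longrightarrow> min_card C \<le>o d" by auto
qed

definition non :: "cantor set set \<Rightarrow> cantor rel" where
  "non J = min_card {|X| | X. X \<notin> J}"

definition minnon :: "cantor rel" where
  "minnon = min_card {non (yorioka f) | f. strict_mono f}"


section \<open>Dominating systems\<close>

definition directed_po :: "'s rel \<Rightarrow> bool" where
  "directed_po P \<longleftrightarrow> Partial_order P \<and>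
    (\<forall>i\<in>Field P. \<forall>j\<in>Field P. \<exists>k\<in>Field P. (i, k) \<in> P \<and> (j, k) \<in> P)"

definition is_minimum :: "'s rel \<Rightarrow> 's \<Rightarrow> bool" where
  "is_minimum P i\<^sub>0 \<longleftrightarrow> i\<^sub>0 \<in> Field P \<and> (\<forall>i\<in>Field P. (i\<^sub>0, i) \<in> P)"

definition yorioka_directed_system :: "(nat \<Rightarrow> nat) \<Rightarrow> 's rel \<Rightarrow> ('s \<Rightarrow> cantor set) \<Rightarrow> bool" where
  "yorioka_directed_system f P A \<longleftrightarrow>
    strict_mono f \<and> directed_po P \<and>
    (\<forall>i\<in>Field P. closure (A i) = UNIV \<and> gdelta_in euclidean (A i) \<and> A i \<in> yorioka f) \<and>
    (\<forall>i j. (i, j) \<in> P \<longrightarrow> A i \<subseteq> A j) \<and>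
    (\<forall>X\<in>yorioka f. \<exists>i\<in>Field P. X \<subseteq> A i)"

definition dominating_family :: "'l set \<Rightarrow> ('l \<Rightarrow> nat \<Rightarrow> nat) \<Rightarrow> bool" where
  "dominating_family I F \<longleftrightarrow> (\<forall>g. \<exists>\<gamma>\<in>I. g \<le>\<^sup>* F \<gamma>)"

text \<open>\<open>underS lam \<gamma>\<close> is \<open>{\<eta>. \<eta> < \<gamma>}\<close>. Indexing the systems by \<open>\<gamma>\<close> instead of by the function
  \<open>F \<gamma>\<close> makes no difference, as the last condition forces \<open>F\<close> to be injective on \<open>Field lam\<close>.\<close>

definition dominating_system ::
    "'l rel \<Rightarrow> 's rel \<Rightarrow> ('l \<Rightarrow> nat \<Rightarrow> nat) \<Rightarrow> ('l \<Rightarrow> 's \<Rightarrow> cantor set) \<Rightarrow> bool" where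
  "dominating_system lam P F A \<longleftrightarrow>
    dominating_family (Field lam) F \<and>
    (\<forall>\<gamma>\<in>Field lam. strict_mono (F \<gamma>)) \<and>
    (\<forall>\<gamma>\<in>Field lam. yorioka_directed_system (F \<gamma>) P (A \<gamma>)) \<and>
    (\<exists>i\<^sub>0. is_minimum P i\<^sub>0 \<and>
      (\<forall>\<gamma>\<in>Field lam. (\<Inter>\<eta>\<in>underS lam \<gamma>. A \<eta> i\<^sub>0) \<notin> yorioka (F \<gamma>)))"

definition prod_ord :: "'k rel \<Rightarrow> 'l rel \<Rightarrow> ('k \<times> 'l) rel" where
  "prod_ord r s = {((a, b), (a', b')). (a, a') \<in> r \<and> (b, b') \<in> s}"

lemma Field_prod_ord:
  assumes "Refl r" "Refl s"
  shows "Field (prod_ord r s) = Field r \<times> Field s"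
  using assms unfolding prod_ord_def Field_def refl_on_def by fast

lemma total_upper_bound:
  assumes "Refl t" "Total t" "a \<in> Field t" "b \<in> Field t"
  shows "\<exists>c\<in>Field t. (a, c) \<in> t \<and> (b, c) \<in> t"
  using assms unfolding total_on_def refl_on_def by metis

lemma directed_po_prod_ord:
  assumes "Well_order r" "Well_order s"
  shows "directed_po (prod_ord r s)"
proof -
  have r: "Refl r" "trans r" "antisym r" "Total r" and s: "Refl s" "trans s" "antisym s" "Total s"
    using assms by (auto simp: order_on_defs)
  have F: "Field (prod_ord r s) = Field r \<times> Field s"
    by (rule Field_prod_ord) (fact r s)+
  have "Refl (prod_ord r s)"
    unfolding refl_on_def F using r(1) s(1) by (auto simp: prod_ord_def refl_on_def)
  moreover have "trans (prod_ord r s)"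
    using r(2) s(2) by (auto simp: prod_ord_def trans_def)
  moreover have "antisym (prod_ord r s)"
    using r(3) s(3) by (auto simp: prod_ord_def antisym_def)
  moreover have "prod_ord r s \<subseteq> Field (prod_ord r s) \<times> Field (prod_ord r s)"
    by (auto simp: Field_def)
  moreover
  have "\<exists>k\<in>Field r \<times> Field s. (i, k) \<in> prod_ord r s \<and> (j, k) \<in> prod_ord r s"
    if ij: "i \<in> Field r \<times> Field s" "j \<in> Field r \<times> Field s" for i j
  proof -
    obtain a where "a \<in> Field r" "(fst i, a) \<in> r" "(fst j, a) \<in> r"
      using total_upper_bound[OF r(1,4), of "fst i" "fst j"] ij unfolding mem_Times_iff by blast
    moreover obtain b where "b \<in> Field s" "(snd i, b) \<in> s" "(snd j, b) \<in> s"
      using total_upper_bound[OF s(1,4), of "snd i" "snd j"] ij unfolding mem_Times_iff by blast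
    ultimately show ?thesis by (intro bexI[of _ "(a, b)"]) (auto simp: prod_ord_def split_beta)
  qed
  ultimately show ?thesis by (auto simp: directed_po_def order_on_defs F)
qed

end

theory Submission
  imports Defs
begin

text \<open>Strong measure zero sets are exactly the sets lying in every \<open>\<I>\<^bsub>f\<^esub>\<close>, and it suffices to
  test this on a dominating family. For \<open>\<gamma> < \<lambda>\<close> and an index \<open>i\<close> pick
  \<open>z \<gamma> i \<in> (\<Inter>\<eta><\<gamma>. A \<eta> i\<^sub>0) - A \<gamma> i\<close>. A set of such points using at
  most \<open>\<mu>\<close> indices for each \<open>\<gamma>\<close>, with \<open>\<mu> < \<lambda>\<close> fixed, has strong measure zero: for every \<open>\<eta>\<close>,
  the points with \<open>\<gamma> > \<eta>\<close> lie in \<open>A \<eta> i\<^sub>0\<close>, and the others are fewer than \<open>\<lambda> \<le> minnon\<close>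
  many, so both parts belong to \<open>\<I>\<^bsub>F \<eta>\<^esub>\<close>. Given
  \<open>x \<in> \<lambda>\<^sup>\<lambda>\<close>, use the indices \<open>(\<alpha>, x \<gamma>)\<close> for all \<open>\<alpha> < \<kappa>\<close> if \<open>\<kappa> < \<lambda>\<close>, and only the diagonal
  index \<open>(x \<gamma>, x \<gamma>)\<close> if \<open>\<kappa> = \<lambda>\<close>. If \<open>A \<gamma> i\<close> covers all these points then \<open>i\<close> is below none
  of the indices used, which bounds \<open>x \<gamma>\<close> in terms of \<open>i\<close>.\<close>

section \<open>Yorioka ideals and their relation to strong measure zero\<close>

lemma mem_cyl_inf: "x \<in> cyl_inf \<sigma> \<longleftrightarrow> (\<forall>m. \<exists>n\<ge>m. initial_seg (\<sigma> n) x)"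
  by (simp add: cyl_inf_def INFM_nat_le)

lemma yorioka_mono: "X \<in> yorioka f \<Longrightarrow> Y \<subseteq> X \<Longrightarrow> Y \<in> yorioka f"
  unfolding yorioka_def by blast

text \<open>Interleave the two covering sequences. Position \<open>i\<close> then carries a string
  of index \<open>i div 2\<close>; this loss is absorbed by using \<open>\<lless>\<close> at
  exponent \<open>2 * k\<close>, as the square of the halved index eventually dominates
  \<open>i\<close>.\<close>

lemma yorioka_Un:
  assumes f: "mono f" and X: "X \<in> yorioka f" and Y: "Y \<in> yorioka f"
  shows "X \<union> Y \<in> yorioka f"
proof -
  obtain \<sigma> where \<sigma>: "X \<subseteq> cyl_inf \<sigma>" "f \<lless> ht \<sigma>" using X unfolding yorioka_def by blast
  obtain \<tau> where \<tau>: "Y \<subseteq> cyl_inf \<tau>" "f \<lless> ht \<tau>" using Y unfolding yorioka_def by blast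
  define \<rho> where "\<rho> n = (if even n then \<sigma> (n div 2) else \<tau> (n div 2))" for n
  have "x \<in> cyl_inf \<rho>" if x: "x \<in> cyl_inf \<sigma>" for x
    unfolding mem_cyl_inf
  proof
    fix m
    obtain n where "n \<ge> m" "initial_seg (\<sigma> n) x"
      using x unfolding mem_cyl_inf by blast
    then show "\<exists>n\<ge>m. initial_seg (\<rho> n) x"
      by (intro exI[of _ "2 * n"]) (auto simp: \<rho>_def)
  qed
  moreover have "x \<in> cyl_inf \<rho>" if x: "x \<in> cyl_inf \<tau>" for x
    unfolding mem_cyl_inf
  proof
    fix m
    obtain n where "n \<ge> m" "initial_seg (\<tau> n) x"
      using x unfolding mem_cyl_inf by blast
    then show "\<exists>n\<ge>m. initial_seg (\<rho> n) x"
      by (intro exI[of _ "Suc (2 * n)"]) (auto simp: \<rho>_def)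
  qed
  moreover have "f \<lless> ht \<rho>"
    unfolding much_less_def
  proof
    fix k
    have "f \<circ> pw (2 * k) \<le>\<^sup>* ht \<sigma>" "f \<circ> pw (2 * k) \<le>\<^sup>* ht \<tau>"
      using \<sigma>(2) \<tau>(2) by (auto simp: much_less_def)
    then have "\<forall>\<^sub>F n in sequentially. f (n ^ (2 * k)) \<le> length (\<sigma> n) \<and> f (n ^ (2 * k)) \<le> length (\<tau> n)"
      unfolding le_star_def by eventually_elim (simp add: pw_def ht_def)
    then obtain N where N: "\<And>n. n \<ge> N \<Longrightarrow> f (n ^ (2 * k)) \<le> length (\<sigma> n)"
      "\<And>n. n \<ge> N \<Longrightarrow> f (n ^ (2 * k)) \<le> length (\<tau> n)"
      unfolding eventually_sequentially by blast
    have "f (i ^ k) \<le> length (\<rho> i)" if i: "i \<ge> 2 * N + 6" for i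
    proof -
      define n where "n = i div 2"
      have n: "n \<ge> N" "n \<ge> 3" using i unfolding n_def by linarith+
      have "i \<le> 3 * n" using n(2) unfolding n_def by linarith
      also have "\<dots> \<le> n * n" using n(2) by (rule mult_right_mono) simp
      finally have "i ^ k \<le> (n\<^sup>2) ^ k"
        unfolding power2_eq_square by (rule power_mono) simp
      then have "f (i ^ k) \<le> f (n ^ (2 * k))"
        unfolding power_mult by (rule monoD[OF f])
      then show ?thesis using N[OF n(1)] unfolding \<rho>_def n_def by (auto intro: order_trans)
    qed
    then show "f \<circ> pw k \<le>\<^sup>* ht \<rho>"
      unfolding le_star_def eventually_sequentially by (auto simp: pw_def ht_def)
  qed
  ultimately show ?thesis using \<sigma>(1) \<tau>(1) unfolding yorioka_def by blast
qed

lemma SN_subset_yorioka: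
  assumes f: "mono f"
  shows "SN \<subseteq> yorioka f"
proof
  fix Y assume "Y \<in> SN"
  then have "\<exists>\<sigma>. (\<forall>n. length (\<sigma> n) = g n) \<and> Y \<subseteq> (\<Union>n. cyl (\<sigma> n))" for g :: "nat \<Rightarrow> nat"
    by (auto simp: SN_def strong_measure_zero_def)
  \<comment> \<open>Covering \<open>Y\<close> once for each class of a partition of the indices into infinitely many
    infinite classes makes it covered infinitely often.\<close>
  from this[of "\<lambda>j. f (prod_encode (m, j) ^ prod_encode (m, j))" for m]
  obtain \<sigma> where len: "\<And>m j. length (\<sigma> m j) = f (prod_encode (m, j) ^ prod_encode (m, j))"
    and cov: "\<And>m. Y \<subseteq> (\<Union>j. cyl (\<sigma> m j))"
    by metis
  define \<tau> where "\<tau> n = (case prod_decode n of (m, j) \<Rightarrow> \<sigma> m j)" for n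
  have "y \<in> cyl_inf \<tau>" if y: "y \<in> Y" for y
    unfolding mem_cyl_inf
  proof
    fix m
    obtain j where "y \<in> cyl (\<sigma> m j)" using cov[of m] y by blast
    then show "\<exists>n\<ge>m. initial_seg (\<tau> n) y"
      by (intro exI[of _ "prod_encode (m, j)"]) (auto simp: \<tau>_def cyl_def le_prod_encode_1)
  qed
  \<comment> \<open>The prescribed length \<open>f (n ^ n)\<close> diagonalises over the exponents:
    it is at least \<open>f (n ^ k)\<close> once \<open>n\<close> exceeds \<open>k\<close>.\<close>
  moreover have "f \<lless> ht \<tau>"
    unfolding much_less_def le_star_def eventually_sequentially
  proof (intro allI exI impI)
    fix k n :: nat assume n: "Suc k \<le> n"
    obtain m j where mj: "n = prod_encode (m, j)" by (metis prod_decode_inverse surj_pair)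
    have "n ^ k \<le> n ^ n" using n by (intro power_increasing) auto
    then show "(f \<circ> pw k) n \<le> ht \<tau> n"
      using monoD[OF f] by (auto simp: mj pw_def ht_def \<tau>_def len)
  qed
  ultimately show "Y \<in> yorioka f" unfolding yorioka_def by blast
qed

text \<open>Exponent 1 already makes all but finitely many strings long enough to be cut to length
  \<open>f n\<close>. The remaining ones may be replaced by filler of the right length, because
  every point is covered infinitely often.\<close>

lemma Inter_yorioka_subset_SN:
  assumes "dominating_family I F"
  shows "(\<Inter>\<gamma>\<in>I. yorioka (F \<gamma>)) \<subseteq> SN"
proof
  fix X assume X: "X \<in> (\<Inter>\<gamma>\<in>I. yorioka (F \<gamma>))"
  have "\<exists>\<sigma>. (\<forall>n. length (\<sigma> n) = f n) \<and> X \<subseteq> (\<Union>n. cyl (\<sigma> n))" for f :: "nat \<Rightarrow> nat"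
  proof -
    obtain \<gamma> where \<gamma>: "\<gamma> \<in> I" "f \<le>\<^sup>* F \<gamma>" using assms by (auto simp: dominating_family_def)
    obtain \<sigma> where \<sigma>: "X \<subseteq> cyl_inf \<sigma>" "F \<gamma> \<lless> ht \<sigma>" using X \<gamma>(1) by (auto simp: yorioka_def)
    have "F \<gamma> \<circ> pw 1 \<le>\<^sup>* ht \<sigma>" using \<sigma>(2) by (auto simp: much_less_def)
    with \<gamma>(2) have "\<forall>\<^sub>F n in sequentially. f n \<le> length (\<sigma> n)"
      unfolding le_star_def by eventually_elim (simp add: pw_def ht_def)
    then obtain N where N: "\<And>n. n \<ge> N \<Longrightarrow> f n \<le> length (\<sigma> n)"
      unfolding eventually_sequentially by blast
    define \<tau> where "\<tau> n = (if n \<ge> N then take (f n) (\<sigma> n) else replicate (f n) False)" for n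
    have "x \<in> (\<Union>n. cyl (\<tau> n))" if x: "x \<in> X" for x
    proof -
      obtain n where "n \<ge> N" "initial_seg (\<sigma> n) x"
        using x \<sigma>(1) mem_cyl_inf by blast
      then have "x \<in> cyl (\<tau> n)" by (auto simp: \<tau>_def cyl_def initial_seg_def)
      then show ?thesis by blast
    qed
    moreover have "length (\<tau> n) = f n" for n using N[of n] by (simp add: \<tau>_def)
    ultimately show ?thesis by blast
  qed
  then show "X \<in> SN" by (auto simp: SN_def strong_measure_zero_def)
qed

lemma card_less_minnon_imp_yorioka:
  assumes "strict_mono f" and "|X| <o minnon"
  shows "X \<in> yorioka f"
proof (rule ccontr)
  assume X: "X \<notin> yorioka f"
  have co: "\<forall>c\<in>{|X| | X. X \<notin> J}. Card_order c" for J :: "cantor set set"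
    by (auto simp: card_of_Card_order)
  \<comment> \<open>\<open>UNIV\<close> is the witness that the minimum defining \<open>non\<close>
    is taken over a nonempty family.\<close>
  have ne: "{|X| | X. X \<notin> yorioka g} \<noteq> {}" if "strict_mono g" for g
    using UNIV_notin_yorioka[OF that] by blast
  have "Card_order (non (yorioka g))" if "strict_mono g" for g
    unfolding non_def using min_card(1)[OF ne[OF that] co] co by blast
  then have "minnon \<le>o non (yorioka f)"
    unfolding minnon_def by (intro min_card(2)) (use assms(1) in auto)
  also have "non (yorioka f) \<le>o |X|"
    unfolding non_def by (intro min_card(2) ne co assms(1)) (use X in auto)
  finally show False using assms(2) not_ordLess_ordLeq by blast
qed

section \<open>Cardinal arithmetic below an infinite cardinal\<close>

lemma finite_ordLess_Cinfinite:
  assumes "finite A" "Cinfinite r"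
  shows "|A| <o r"
  by (rule Cfinite_ordLess_Cinfinite) (use assms in \<open>auto simp: cfinite_def card_of_card_order_on Field_card_of\<close>)

lemma Times_ordLess_Cinfinite:
  assumes r: "Cinfinite r" and A: "|A| <o r" and B: "|B| <o r"
  shows "|A \<times> B| <o r"
proof (cases "finite A \<and> finite B")
  case True
  then show ?thesis using r by (auto intro: finite_ordLess_Cinfinite)
next
  case False
  \<comment> \<open>The disjoint union is an infinite set of size below \<open>r\<close> dominating both factors.\<close>
  let ?C = "A <+> B"
  have inf: "\<not> finite (Field |?C| )"
    using False by (simp add: Field_card_of)
  have "|A \<times> B| \<le>o |?C|"
    by (rule card_of_Times_ordLeq_infinite_Field[OF inf card_of_Plus1 card_of_Plus2 card_of_Card_order])
  also have "|?C| <o r"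
    using r A B by (intro card_of_Plus_ordLess_infinite_Field) (auto simp: cinfinite_def)
  finally show ?thesis .
qed

lemma card_of_under_ordLess:
  assumes r: "Cinfinite r" and a: "a \<in> Field r"
  shows "|under r a| <o r"
proof -
  have "|under r a| \<le>o |{a} \<union> underS r a|"
    by (rule card_of_mono1) (auto simp: under_def underS_def)
  also have "|{a} \<union> underS r a| <o r"
    using card_of_underS[of r a] r a
    by (intro Un_Cinfinite_bound_strict) (auto intro: finite_ordLess_Cinfinite)
  finally show ?thesis .
qed

section \<open>The Tukey reduction obtained from a dominating system\<close>

text \<open>The requirement on \<open>d\<close> says that \<open>\<lambda>\<close> is Tukey below \<open>P\<close>, up to replacing single indices
  by families of fewer than \<open>\<lambda>\<close> many of them.\<close>

lemma dominating_system_imp_tukey_le: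
  fixes d :: "'k \<Rightarrow> 'l \<Rightarrow> 's"
  assumes lam: "Cinfinite lam" "lam \<le>o minnon"
    and sys: "dominating_system lam P F A"
    and K: "|K| <o lam"
    and d: "\<And>k \<delta>. k \<in> K \<Longrightarrow> \<delta> \<in> Field lam \<Longrightarrow> d k \<delta> \<in> Field P"
    and bound: "\<And>i. i \<in> Field P \<Longrightarrow>
      \<exists>\<beta>\<in>Field lam. \<forall>\<delta>\<in>Field lam. (\<forall>k\<in>K. (i, d k \<delta>) \<notin> P) \<longrightarrow> (\<delta>, \<beta>) \<in> lam"
  shows "dom_sys lam \<preceq>\<^sub>T incl_sys SN"
proof -
  have lin: "Total lam" "Refl lam"
    using lam(1) by (auto simp: card_order_on_def order_on_defs)
  have F: "dominating_family (Field lam) F" "\<And>\<gamma>. \<gamma> \<in> Field lam \<Longrightarrow> strict_mono (F \<gamma>)"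
    and A: "\<And>\<gamma>. \<gamma> \<in> Field lam \<Longrightarrow> yorioka_directed_system (F \<gamma>) P (A \<gamma>)"
    using sys by (auto simp: dominating_system_def)
  obtain i0 where i0: "i0 \<in> Field P"
    and not_yor: "\<And>\<gamma>. \<gamma> \<in> Field lam \<Longrightarrow> (\<Inter>\<eta>\<in>underS lam \<gamma>. A \<eta> i0) \<notin> yorioka (F \<gamma>)"
    using sys by (auto simp: dominating_system_def is_minimum_def)
  have A_yor: "A \<gamma> i \<in> yorioka (F \<gamma>)" if "\<gamma> \<in> Field lam" "i \<in> Field P" for \<gamma> i
    using A[OF that(1)] that(2) by (simp add: yorioka_directed_system_def)
  have A_mono: "A \<gamma> i \<subseteq> A \<gamma> j" if "\<gamma> \<in> Field lam" "(i, j) \<in> P" for \<gamma> i j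
    using A[OF that(1)] that(2) unfolding yorioka_directed_system_def by blast
  have A_cof: "\<exists>i\<in>Field P. X \<subseteq> A \<gamma> i" if "\<gamma> \<in> Field lam" "X \<in> yorioka (F \<gamma>)" for \<gamma> X
    using A[OF that(1)] that(2) unfolding yorioka_directed_system_def by blast
  have "\<exists>z. z \<in> (\<Inter>\<eta>\<in>underS lam \<gamma>. A \<eta> i0) - A \<gamma> i" if "\<gamma> \<in> Field lam" "i \<in> Field P" for \<gamma> i
    using not_yor[OF that(1)] yorioka_mono[OF A_yor[OF that]] by blast
  then obtain z where z: "\<And>\<gamma> i. \<gamma> \<in> Field lam \<Longrightarrow> i \<in> Field P \<Longrightarrow>
      z \<gamma> i \<in> (\<Inter>\<eta>\<in>underS lam \<gamma>. A \<eta> i0) - A \<gamma> i"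
    by metis
  define \<Psi>1 where "\<Psi>1 x = (\<lambda>(\<gamma>, k). z \<gamma> (d k (x \<gamma>))) ` (Field lam \<times> K)" for x
  have \<Psi>1: "\<Psi>1 x \<in> SN" if x: "x \<in> self_maps lam" for x
  proof (rule subsetD[OF Inter_yorioka_subset_SN[OF F(1)]], rule INT_I)
    fix \<eta> assume \<eta>: "\<eta> \<in> Field lam"
    let ?S = "(\<lambda>(\<gamma>, k). z \<gamma> (d k (x \<gamma>))) ` (under lam \<eta> \<times> K)"
    have "|?S| \<le>o |under lam \<eta> \<times> K|" by (rule card_of_image)
    also have "|under lam \<eta> \<times> K| <o lam" 
      using lam(1) \<eta> K by (intro Times_ordLess_Cinfinite card_of_under_ordLess)
    also note lam(2)
    finally have "?S \<in> yorioka (F \<eta>)"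
      by (rule card_less_minnon_imp_yorioka[OF F(2)[OF \<eta>]])
    then have yor: "A \<eta> i0 \<union> ?S \<in> yorioka (F \<eta>)"
      by (intro yorioka_Un strict_mono_mono F(2) \<eta> A_yor i0)
    have "z \<gamma> (d k (x \<gamma>)) \<in> A \<eta> i0 \<union> ?S" if "\<gamma> \<in> Field lam" "k \<in> K" for \<gamma> k
    proof (cases "\<gamma> \<in> under lam \<eta>")
      case False
      then have "\<eta> \<in> underS lam \<gamma>"
        using lin that(1) \<eta> unfolding under_def underS_def total_on_def refl_on_def mem_Collect_eq
        by metis
      moreover have "x \<gamma> \<in> Field lam" using x that(1) by (auto simp: self_maps_def)
      ultimately show ?thesis using z[OF that(1) d[OF that(2)]] by blast
    qed (use that in force)
    then show "\<Psi>1 x \<in> yorioka (F \<eta>)"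
      unfolding \<Psi>1_def by (intro yorioka_mono[OF yor]) auto
  qed
  obtain b where b: "\<And>i. i \<in> Field P \<Longrightarrow> b i \<in> Field lam"
    "\<And>i \<delta>. i \<in> Field P \<Longrightarrow> \<delta> \<in> Field lam \<Longrightarrow> (\<And>k. k \<in> K \<Longrightarrow> (i, d k \<delta>) \<notin> P) \<Longrightarrow> (\<delta>, b i) \<in> lam"
    using bound by metis
  have "\<exists>i\<in>Field P. Y \<subseteq> A \<gamma> i" if "Y \<in> SN" "\<gamma> \<in> Field lam" for Y \<gamma>
    using A_cof[OF that(2)] SN_subset_yorioka[OF strict_mono_mono[OF F(2)[OF that(2)]]] that(1)
    by blast
  then obtain c where c: "\<And>Y \<gamma>. Y \<in> SN \<Longrightarrow> \<gamma> \<in> Field lam \<Longrightarrow> c Y \<gamma> \<in> Field P"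
    "\<And>Y \<gamma>. Y \<in> SN \<Longrightarrow> \<gamma> \<in> Field lam \<Longrightarrow> Y \<subseteq> A \<gamma> (c Y \<gamma>)"
    by metis
  \<comment> \<open>\<open>c Y \<gamma>\<close> is an index whose set at level
    \<open>\<gamma>\<close> contains \<open>Y\<close>; \<open>b\<close> turns it into an ordinal
    bound.\<close>
  define \<Psi>2 where "\<Psi>2 Y = (\<lambda>\<gamma>\<in>Field lam. b (c Y \<gamma>))" for Y
  have \<Psi>2: "\<Psi>2 Y \<in> self_maps lam" if "Y \<in> SN" for Y
    using b(1) c(1) that by (auto simp: \<Psi>2_def self_maps_def)
  have "(x \<gamma>, \<Psi>2 Y \<gamma>) \<in> lam"
    if x: "x \<in> self_maps lam" and Y: "Y \<in> SN" "\<Psi>1 x \<subseteq> Y" and \<gamma>: "\<gamma> \<in> Field lam" for x Y \<gamma>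
  proof -
    have x\<gamma>: "x \<gamma> \<in> Field lam" using x \<gamma> by (auto simp: self_maps_def)
    \<comment> \<open>Otherwise monotonicity would place the point
      \<open>z \<gamma> (d k (x \<gamma>))\<close> in the very set it was chosen to avoid.\<close>
    have "(c Y \<gamma>, d k (x \<gamma>)) \<notin> P" if k: "k \<in> K" for k
    proof
      assume "(c Y \<gamma>, d k (x \<gamma>)) \<in> P"
      then have "Y \<subseteq> A \<gamma> (d k (x \<gamma>))" using A_mono[OF \<gamma>] c(2)[OF Y(1) \<gamma>] by blast
      moreover have "z \<gamma> (d k (x \<gamma>)) \<in> \<Psi>1 x" using \<gamma> k by (force simp: \<Psi>1_def)
      ultimately show False using z[OF \<gamma> d[OF k x\<gamma>]] Y(2) by blast
    qed
    then show ?thesis using b(2)[OF c(1)[OF Y(1) \<gamma>] x\<gamma>] \<gamma> by (simp add: \<Psi>2_def)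
  qed
  then have "(x, \<Psi>2 Y) \<in> {(f, g) \<in> self_maps lam \<times> self_maps lam. \<forall>\<alpha>\<in>Field lam. (f \<alpha>, g \<alpha>) \<in> lam}"
    if "x \<in> self_maps lam" "Y \<in> SN" "\<Psi>1 x \<subseteq> Y" for x Y
    using that \<Psi>2 by simp
  moreover have "\<Psi>1 \<in> self_maps lam \<rightarrow> SN" "\<Psi>2 \<in> SN \<rightarrow> self_maps lam"
    using \<Psi>1 \<Psi>2 by simp_all
  ultimately show ?thesis
    unfolding tukey_le_def dom_sys_def incl_sys_def prod.case by blast
qed

section \<open>The cases of smaller and of equal cardinals\<close>

theorem theorem3p10:
  fixes \<kappa> :: "'k rel" and lam :: "'l rel"
  assumes "Cinfinite \<kappa>" and "Cinfinite lam" and "\<kappa> \<le>o lam"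
    and "lam \<le>o minnon"
    and "\<exists>F A. dominating_system lam (prod_ord \<kappa> lam) F A"
  shows "dom_sys lam \<preceq>\<^sub>T incl_sys SN"
proof -
  obtain F A where sys: "dominating_system lam (prod_ord \<kappa> lam) F A" using assms(5) by blast
  have \<kappa>: "Card_order \<kappa>" "Refl \<kappa>"
    and lam: "Card_order lam" "Refl lam" "Total lam" "trans lam"
    using assms(1,2) by (auto simp: card_order_on_def order_on_defs)
  have Field: "Field (prod_ord \<kappa> lam) = Field \<kappa> \<times> Field lam"
    by (rule Field_prod_ord[OF \<kappa>(2) lam(2)])
  have linear: "(a, b) \<in> lam \<or> (b, a) \<in> lam" if "a \<in> Field lam" "b \<in> Field lam" for a b
    using lam(2,3) that unfolding refl_on_def total_on_def by metis
  from assms(3) consider "\<kappa> <o lam" | "lam =o \<kappa>"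
    using ordLeq_iff_ordLess_or_ordIso ordIso_symmetric by blast
  then show ?thesis
  proof cases
    case 1
    have "|Field \<kappa>| <o lam"
      using card_of_Field_ordIso[OF \<kappa>(1)] 1 by (rule ordIso_ordLess_trans)
    then show ?thesis
    proof (rule dominating_system_imp_tukey_le[OF assms(2,4) sys, where d = Pair])
      fix i assume "i \<in> Field (prod_ord \<kappa> lam)"
      then obtain \<alpha> \<beta> where i: "i = (\<alpha>, \<beta>)" "\<alpha> \<in> Field \<kappa>" "\<beta> \<in> Field lam" by (auto simp: Field)
      \<comment> \<open>With \<open>k = \<alpha>\<close> the first coordinates agree, so a failure
        of the product order must come from the second.\<close>
      have "(\<alpha>, \<alpha>) \<in> \<kappa>" using \<kappa>(2) i(2) by (auto simp: refl_on_def)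
      then show "\<exists>\<beta>\<in>Field lam. \<forall>\<delta>\<in>Field lam.
          (\<forall>k\<in>Field \<kappa>. (i, (k, \<delta>)) \<notin> prod_ord \<kappa> lam) \<longrightarrow> (\<delta>, \<beta>) \<in> lam"
        using i linear by (intro bexI[of _ \<beta>]) (auto simp: prod_ord_def)
    qed (auto simp: Field)
  next
    case 2
    then obtain h where h: "iso lam \<kappa> h" by (auto simp: ordIso_def)
    then have bij: "bij_betw h (Field lam) (Field \<kappa>)" by (simp add: iso_def)
    \<comment> \<open>\<open>Field \<kappa>\<close> is now too large to serve as \<open>K\<close>. A
      dummy singleton leaves one diagonal index per \<open>\<delta>\<close>.\<close>
    have "|{undefined :: 'k}| <o lam"
      using assms(2) by (intro finite_ordLess_Cinfinite) auto
    then show ?thesis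
    proof (rule dominating_system_imp_tukey_le[OF assms(2,4) sys, where d = "\<lambda>_ \<delta>. (h \<delta>, \<delta>)"])
      fix i assume "i \<in> Field (prod_ord \<kappa> lam)"
      then obtain \<alpha> \<beta> where i: "i = (h \<alpha>, \<beta>)" "\<alpha> \<in> Field lam" "\<beta> \<in> Field lam"
        using bij unfolding Field bij_betw_def by blast
      \<comment> \<open>Failure in either coordinate bounds \<open>\<delta>\<close> by
        \<open>\<alpha>\<close> or by \<open>\<beta>\<close>, hence by any common upper
        bound.\<close>
      obtain \<epsilon> where \<epsilon>: "\<epsilon> \<in> Field lam" "(\<alpha>, \<epsilon>) \<in> lam" "(\<beta>, \<epsilon>) \<in> lam"
        using total_upper_bound[OF lam(2,3) i(2,3)] by blast
      have "(\<delta>, \<epsilon>) \<in> lam" if "\<delta> \<in> Field lam" "(i, (h \<delta>, \<delta>)) \<notin> prod_ord \<kappa> lam" for \<delta>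
      proof -
        have "(\<alpha>, \<delta>) \<notin> lam \<or> (\<beta>, \<delta>) \<notin> lam"
          using that(2) iso_forward[OF _ h] i(1) by (auto simp: prod_ord_def)
        then have "(\<delta>, \<alpha>) \<in> lam \<or> (\<delta>, \<beta>) \<in> lam" using linear i(2,3) that(1) by blast
        then show ?thesis using \<epsilon>(2,3) lam(4) by (meson transD)
      qed
      then show "\<exists>\<beta>\<in>Field lam. \<forall>\<delta>\<in>Field lam.
          (\<forall>k\<in>{undefined :: 'k}. (i, (h \<delta>, \<delta>)) \<notin> prod_ord \<kappa> lam) \<longrightarrow> (\<delta>, \<beta>) \<in> lam"
        using \<epsilon>(1) by blast
    qed (use bij in \<open>auto simp: Field bij_betw_def\<close>)
  qed
qed

end
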